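(* Let $(\mathbb{P},\leq)$ be any poset. The spectrum $\mathsf{S}\mathbb{P}$ is a compact $T_1$ space. Moreover, a subset $C\subseteq\mathbb{P}$ is a cap of $\mathbb{P}$ if and only if the corresponding subbasic sets $C_{\mathsf{S}}=\{c^\in:c\in C\}$ cover the whole spectrum, i.e. $\bigcup_{c\in C}c^\in=\mathsf{S}\mathbb{P}$.
   Context: Let $(\mathbb{P},\leq)$ be a poset. A subset $S\subseteq\mathbb{P}$ refines $T\subseteq\mathbb{P}$ if for every $s\in S$ there is $t\in T$ with $s\leq t$. A band of $\mathbb{P}$ is a finite subset $B\subseteq\mathbb{P}$ such that every $p\in\mathbb{P}$ is comparable to some $b\in B$. A cap of $\mathbb{P}$ is a subset refined by some band. A selector is a subset $S\subseteq\mathbb{P}$ with $S\cap C\neq\emptyset$ for every cap $C$ of $\mathbb{P}$; a minimal selector is one minimal with respect to inclusion among all selectors. The spectrum $\mathsf{S}\mathbb{P}$ is the set of all minimal selectors, with the topology generated by the subbasis consisting of the sets $p^\in=\{S\in\mathsf{S}\mathbb{P}:p\in S\}$, for $p\in\mathbb{P}$. *)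

theory Defs
  imports "HOL-Analysis.Analysis"
begin

text \<open>
  A poset is given by a carrier \<open>P\<close> (possibly empty) and a relation \<open>r\<close> with
  \<^const>\<open>partial_order_on\<close> \<open>P r\<close>; \<open>(x, y) \<in> r\<close> stands for \<open>x \<le> y\<close>.
\<close>

definition refines :: "'a rel \<Rightarrow> 'a set \<Rightarrow> 'a set \<Rightarrow> bool" where
  "refines r S T \<longleftrightarrow> (\<forall>s\<in>S. \<exists>t\<in>T. (s, t) \<in> r)"

definition band :: "'a set \<Rightarrow> 'a rel \<Rightarrow> 'a set \<Rightarrow> bool" where
  "band P r B \<longleftrightarrow> finite B \<and> B \<subseteq> P \<and> (\<forall>p\<in>P. \<exists>b\<in>B. (p, b) \<in> r \<or> (b, p) \<in> r)"

definition cap :: "'a set \<Rightarrow> 'a rel \<Rightarrow> 'a set \<Rightarrow> bool" where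
  "cap P r C \<longleftrightarrow> C \<subseteq> P \<and> (\<exists>B. band P r B \<and> refines r B C)"

definition selector :: "'a set \<Rightarrow> 'a rel \<Rightarrow> 'a set \<Rightarrow> bool" where
  "selector P r S \<longleftrightarrow> S \<subseteq> P \<and> (\<forall>C. cap P r C \<longrightarrow> S \<inter> C \<noteq> {})"

definition minimal_selector :: "'a set \<Rightarrow> 'a rel \<Rightarrow> 'a set \<Rightarrow> bool" where
  "minimal_selector P r S \<longleftrightarrow>
     selector P r S \<and> (\<forall>T. selector P r T \<and> T \<subseteq> S \<longrightarrow> T = S)"

definition spectrum :: "'a set \<Rightarrow> 'a rel \<Rightarrow> 'a set set" where
  "spectrum P r = {S. minimal_selector P r S}"

definition subbasic :: "'a set \<Rightarrow> 'a rel \<Rightarrow> 'a \<Rightarrow> 'a set set" where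
  "subbasic P r p = {S \<in> spectrum P r. p \<in> S}"

text \<open>
  The subbasis need not cover the spectrum: if \<open>P\<close> has no bands (e.g. an infinite
  antichain), the only minimal selector is \<open>{}\<close> and every subbasic set is empty.
  Hence the empty intersection has to be read as the whole spectrum, which is what
  \<open>relative_to\<close> does below, whereas \<^const>\<open>topology_generated_by\<close> would take the union of
  the subbasis as the underlying space.
\<close>

definition spectrum_topology :: "'a set \<Rightarrow> 'a rel \<Rightarrow> 'a set topology" where
  "spectrum_topology P r =
     topology (arbitrary union_of
       (finite intersection_of (\<lambda>U. U \<in> subbasic P r ` P) relative_to spectrum P r))"

lemma topspace_spectrum_topology: "topspace (spectrum_topology P r) = spectrum P r"
  unfolding spectrum_topology_def by (rule topspace_subbase)

end

theory Submission
  imports Defs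
begin

text \<open>
  Everything rests on two properties of caps: supersets of caps (within \<open>P\<close>) are caps, and,
  since bands are finite, every cap contains a finite cap.  The first makes the selectors exactly
  the complements in \<open>P\<close> of the non-caps (\<open>selector_iff_complement_not_cap\<close>), so the points of the
  spectrum are the complements of the maximal non-caps.  The second says that being a non-cap
  is a property of finite character, so by Zorn's lemma every non-cap lies in a maximal one
  (\<open>selector_contains_minimal_selector\<close>).

  This settles the covering criterion: minimal selectors meet every cap, while the complement of
  a maximal non-cap containing \<open>C\<close> is a minimal selector disjoint from \<open>C\<close>.  Hence a cover by
  subbasic sets is indexed by a cap, a finite cap inside it indexes a finite subcover, and
  Alexander's subbase theorem yields compactness.  The \<open>T\<^sub>1\<close> property holds because distinct
  minimal selectors cannot be nested.
\<close>

lemma cap_mono: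
  assumes "cap P r C" "C \<subseteq> D" "D \<subseteq> P"
  shows "cap P r D"
  using assms unfolding cap_def refines_def by blast

text \<open>A band refining the cap is finite, and one upper bound for each of its elements suffices.\<close>

lemma cap_contains_finite_cap:
  assumes "cap P r C"
  obtains F where "finite F" "F \<subseteq> C" "cap P r F"
proof -
  obtain B where C: "C \<subseteq> P" and B: "band P r B" and "refines r B C"
    using assms unfolding cap_def by blast
  then obtain f where f: "\<And>b. b \<in> B \<Longrightarrow> f b \<in> C \<and> (b, f b) \<in> r"
    unfolding refines_def by metis
  show thesis
  proof
    show "finite (f ` B)"
      using B by (simp add: band_def)
    show "f ` B \<subseteq> C"
      using f by blast
    then show "cap P r (f ` B)"
      using B C f unfolding cap_def refines_def by blast
  qed
qed

lemma selector_iff_complement_not_cap: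
  assumes "S \<subseteq> P"
  shows "selector P r S \<longleftrightarrow> \<not> cap P r (P - S)"
proof
  assume "selector P r S"
  then show "\<not> cap P r (P - S)"
    unfolding selector_def by blast
next
  assume nc: "\<not> cap P r (P - S)"
  have "S \<inter> C \<noteq> {}" if "cap P r C" for C
  proof
    assume "S \<inter> C = {}"
    moreover have "C \<subseteq> P"
      using that by (simp add: cap_def)
    ultimately have "cap P r (P - S)"
      using that cap_mono[of P r C "P - S"] by blast
    with nc show False ..
  qed
  with assms show "selector P r S"
    by (simp add: selector_def)
qed

text \<open>
  Zorn's lemma applies to the non-caps containing the complement of the selector: were the union
  of a chain of non-caps a cap, a finite cap inside the union would already lie in one member.
\<close>

lemma selector_contains_minimal_selector:
  assumes "selector P r S"
  obtains M where "minimal_selector P r M" "M \<subseteq> S"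
proof -
  have SP: "S \<subseteq> P"
    using assms by (simp add: selector_def)
  define \<A> where "\<A> = {N. P - S \<subseteq> N \<and> N \<subseteq> P \<and> \<not> cap P r N}"
  have nonempty: "P - S \<in> \<A>"
    using assms SP by (simp add: \<A>_def selector_iff_complement_not_cap)
  have Union_chain: "\<Union>\<C> \<in> \<A>" if ne: "\<C> \<noteq> {}" and chain: "subset.chain \<A> \<C>" for \<C>
  proof -
    have \<C>: "P - S \<subseteq> N \<and> N \<subseteq> P \<and> \<not> cap P r N" if "N \<in> \<C>" for N
      using that chain by (auto simp: \<A>_def subset.chain_def)
    have "\<not> cap P r (\<Union>\<C>)"
    proof
      assume "cap P r (\<Union>\<C>)"
      then obtain F where "finite F" "F \<subseteq> \<Union>\<C>" and F: "cap P r F"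
        by (rule cap_contains_finite_cap)
      from this(1,2) obtain N where "N \<in> \<C>" "F \<subseteq> N"
        by (rule finite_subset_Union_chain[OF _ _ ne chain])
      then show False
        using \<C>[of N] cap_mono[OF F, of N] by simp
    qed
    then show ?thesis
      using \<C> ne unfolding \<A>_def by blast
  qed
  have "\<exists>N\<in>\<A>. \<forall>X\<in>\<A>. N \<subseteq> X \<longrightarrow> X = N"
  proof (rule subset_Zorn_nonempty)
    show "\<A> \<noteq> {}"
      using nonempty by blast
  qed (fact Union_chain)
  then obtain N where "N \<in> \<A>" and max: "\<And>X. X \<in> \<A> \<Longrightarrow> N \<subseteq> X \<Longrightarrow> X = N"
    by blast
  then have N: "P - S \<subseteq> N" "N \<subseteq> P" "\<not> cap P r N"
    by (auto simp: \<A>_def)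
  show thesis
  proof
    show "P - N \<subseteq> S"
      using N by blast
    show "minimal_selector P r (P - N)"
      unfolding minimal_selector_def
    proof (intro conjI allI impI)
      show "selector P r (P - N)"
        using N by (simp add: selector_iff_complement_not_cap double_diff)
      fix T
      assume T: "selector P r T \<and> T \<subseteq> P - N"
      moreover from this have "T \<subseteq> P"
        by blast
      ultimately have "\<not> cap P r (P - T)"
        by (simp add: selector_iff_complement_not_cap)
      then have "P - T \<in> \<A>"
        using N T by (auto simp: \<A>_def)
      then have "P - T = N"
        by (rule max) (use T N in blast)
      then show "T = P - N"
        using \<open>T \<subseteq> P\<close> by blast
    qed
  qed
qed

theorem cap_iff_subbasic_cover:
  assumes "C \<subseteq> P"
  shows "cap P r C \<longleftrightarrow> (\<Union>c\<in>C. subbasic P r c) = spectrum P r"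
proof
  assume "cap P r C"
  then have "S \<inter> C \<noteq> {}" if "S \<in> spectrum P r" for S
    using that by (simp add: spectrum_def minimal_selector_def selector_def)
  then show "(\<Union>c\<in>C. subbasic P r c) = spectrum P r"
    by (auto simp: subbasic_def)
next
  assume cover: "(\<Union>c\<in>C. subbasic P r c) = spectrum P r"
  show "cap P r C"
  proof (rule ccontr)
    assume "\<not> cap P r C"
    then have "selector P r (P - C)"
      using assms by (simp add: selector_iff_complement_not_cap double_diff)
    then obtain M where "minimal_selector P r M" "M \<subseteq> P - C"
      by (rule selector_contains_minimal_selector)
    moreover from this have "M \<in> (\<Union>c\<in>C. subbasic P r c)"
      by (simp add: cover spectrum_def)
    ultimately show False
      by (auto simp: subbasic_def)
  qed
qed

text \<open>
  If \<open>P\<close> is a cap, the subbasis covers the spectrum and Alexander's theorem applies.  Otherwise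
  there are no caps at all, the empty set is a selector, and the spectrum is a single point.
\<close>

lemma compact_spectrum: "compact_space (spectrum_topology P r)"
proof (cases "cap P r P")
  case True
  show ?thesis
  proof (rule Alexander_subbase_alt)
    show "spectrum P r \<subseteq> \<Union>(subbasic P r ` P)"
      using True cap_iff_subbasic_cover[of P P r] by simp
    show "topology (arbitrary union_of (finite intersection_of
            (\<lambda>U. U \<in> subbasic P r ` P) relative_to spectrum P r)) = spectrum_topology P r"
      by (simp add: spectrum_topology_def)
  next
    fix \<U>
    assume "\<U> \<subseteq> subbasic P r ` P" and cover: "spectrum P r \<subseteq> \<Union>\<U>"
    then obtain C where C: "C \<subseteq> P" "\<U> = subbasic P r ` C"
      by (auto simp: subset_image_iff)
    then have "(\<Union>c\<in>C. subbasic P r c) = spectrum P r"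
      using cover by (auto simp: subbasic_def)
    then have "cap P r C"
      using C cap_iff_subbasic_cover by metis
    then obtain F where F: "finite F" "F \<subseteq> C" "cap P r F"
      by (rule cap_contains_finite_cap)
    then have "(\<Union>c\<in>F. subbasic P r c) = spectrum P r"
      using C cap_iff_subbasic_cover[of F P r] by blast
    then show "\<exists>\<U>'. finite \<U>' \<and> \<U>' \<subseteq> \<U> \<and> spectrum P r \<subseteq> \<Union>\<U>'"
      using F C by (intro exI[of _ "subbasic P r ` F"]) auto
  qed
next
  case False
  then have "\<not> cap P r C" for C
    using cap_mono[of P r C P] by (auto simp: cap_def)
  then have "selector P r {}"
    by (simp add: selector_def)
  then have "spectrum P r \<subseteq> {{}}"
    by (auto simp: spectrum_def minimal_selector_def)
  then have "finite (spectrum P r)"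
    by (rule finite_subset) simp
  then show ?thesis
    by (simp add: compact_space_def finite_imp_compactin topspace_spectrum_topology)
qed

lemma openin_subbasic:
  assumes "p \<in> P"
  shows "openin (spectrum_topology P r) (subbasic P r p)"
proof -
  have "subbasic P r p \<subseteq> spectrum P r"
    by (auto simp: subbasic_def)
  with assms show ?thesis
    by (simp add: spectrum_topology_def openin_subbase arbitrary_union_of_inc
        finite_intersection_of_inc relative_to_subset_inc)
qed

lemma t1_spectrum: "t1_space (spectrum_topology P r)"
  unfolding t1_space_def topspace_spectrum_topology
proof (intro ballI impI)
  fix S T
  assume S: "S \<in> spectrum P r" and T: "T \<in> spectrum P r" and "S \<noteq> T"
  then have "\<not> S \<subseteq> T"
    by (auto simp: spectrum_def minimal_selector_def)
  then obtain p where p: "p \<in> S" "p \<notin> T"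
    by blast
  then have "p \<in> P"
    using S by (auto simp: spectrum_def minimal_selector_def selector_def)
  then show "\<exists>U. openin (spectrum_topology P r) U \<and> S \<in> U \<and> T \<notin> U"
    using S p openin_subbasic by (intro exI[of _ "subbasic P r p"]) (auto simp: subbasic_def)
qed

theorem proposition2p8:
  fixes P :: "'a set" and r :: "'a rel"
  assumes "partial_order_on P r"
  shows "compact_space (spectrum_topology P r) \<and>
         t1_space (spectrum_topology P r) \<and>
         (\<forall>C. C \<subseteq> P \<longrightarrow>
            (cap P r C \<longleftrightarrow> (\<Union>c\<in>C. subbasic P r c) = spectrum P r))"
  using compact_spectrum t1_spectrum cap_iff_subbasic_cover by blast

end
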